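(* Let $\mathcal{A}$ be a cluster algebra of rank $n$ (trivial coefficients) with a fixed cluster pattern $\mathbf{\Sigma}=\{\Sigma_t=(\mathbf{x}_t,B_t)\}_{t\in\mathbb{T}_n}$ with root vertex $t_0$, and assume its exchange matrices are indecomposable. For $m\in\mathbb{N}=\{0,1,2,\dots\}$ let $G_m(t_0)\subset\operatorname{Aut}(\mathcal{A})$ be the set of cluster automorphisms $f$ for which there exist $s\in\mathbb{T}_n$, $\sigma\in S_n$ and $\varepsilon\in\{\pm\}$ with $\mathbf{w}_{t_0}(t_0,s)=m+1$ and $f=(\Sigma_{t_0},\Sigma_s,\sigma,\varepsilon)$. Then: (1) $\operatorname{Aut}(\mathcal{A})=\bigcup_{m\in\mathbb{N}}G_m(t_0)$; (2) $G_0(t_0)$ is a subgroup of $\operatorname{Aut}(\mathcal{A})$; (3) for any $k,l\in\mathbb{N}$, $f\in G_k(t_0)$ and $g\in G_l(t_0)$, we have $g\circ f\in\bigcup_{m=0}^{k+l}G_m(t_0)$.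
   Context: Cluster algebras. Write $[x]_+=\max\{x,0\}$. An $n\times n$ integer matrix $B=(b_{ij})$ is skew-symmetrizable if $DB$ is skew-symmetric for some diagonal matrix $D$ with positive integer diagonal entries. It is indecomposable if the graph on $\{1,\dots,n\}$ with an edge between $i,j$ whenever $b_{ij}\ne0$ is connected. Let $\mathcal{F}$ be a field isomorphic to the field of rational functions over $\mathbb{Q}$ in $n$ variables. A labeled seed is a pair $\Sigma=(\mathbf{x},B)$ with $\mathbf{x}=(x_1,\dots,x_n)$ (the cluster) a free generating set of $\mathcal{F}$ and $B$ skew-symmetrizable (the exchange matrix). The mutation $\mu_k(\Sigma)=(\mathbf{x}',B')$ is given by $b'_{ij}=-b_{ij}$ if $i=k$ or $j=k$, $b'_{ij}=b_{ij}+b_{ik}[b_{kj}]_++[-b_{ik}]_+b_{kj}$ otherwise; $x'_i=x_i$ for $i\ne k$ and $x_k'=x_k^{-1}\big(\prod_j x_j^{[b_{jk}]_+}+\prod_j x_j^{[-b_{jk}]_+}\big)$. $\mathbb{T}_n$ is the $n$-regular tree with edges labeled by $1,\dots,n$, the $n$ edges at each vertex having distinct labels. A cluster pattern is a family $\mathbf{\Sigma}=\{\Sigma_t=(\mathbf{x}_t,B_t)\}_{t\in\mathbb{T}_n}$ of labeled seeds such that $\Sigma_{t'}=\mu_k(\Sigma_t)$ whenever $t,t'$ are joined by an edge labeled $k$; $t_0$ is a fixed root vertex. The cluster algebra $\mathcal{A}$ is the $\mathbb{Z}$-subalgebra of $\mathcal{F}$ generated by all cluster variables (entries of all $\mathbf{x}_t$).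 $S_n$-action. For $\sigma\in S_n$: $(\sigma\mathbf{x})_i=x_{\sigma^{-1}(i)}$ and $(\sigma B)_{ij}=b_{\sigma^{-1}(i)\sigma^{-1}(j)}$. Write $B\sim B'$ if $B'=\sigma B$ for some $\sigma\in S_n$, and $B\sim\pm B'$ if $B\sim B'$ or $B\sim -B'$. Cluster automorphisms. A $\mathbb{Z}$-algebra automorphism $f:\mathcal{A}\to\mathcal{A}$ is a cluster automorphism if there exist labeled seeds $(\mathbf{x},B),(\mathbf{x}',B')$ in $\mathbf{\Sigma}$ and $\sigma\in S_n$ such that $\sigma f(\mathbf{x})=\mathbf{x}'$ and $\sigma f(\mu_k(\mathbf{x}))=\mu_{\sigma(k)}(\mathbf{x}')$ for all $k$. $\operatorname{Aut}(\mathcal{A})$ is the group of cluster automorphisms under composition. If $\Sigma_1=(\mathbf{x}_1,B_1)$, $\Sigma_2=(\mathbf{x}_2,B_2)$ are seeds of $\mathbf{\Sigma}$ and $\sigma B_1=\varepsilon B_2$ with $\sigma\in S_n$, $\varepsilon\in\{\pm\}$, then $(\Sigma_1,\Sigma_2,\sigma,\varepsilon)$ denotes the unique cluster automorphism $f$ with $\sigma f(\mathbf{x}_1)=\mathbf{x}_2$; writing this quadruple presupposes $\sigma B_1=\varepsilon B_2$. Weight. $p(t,t')$ is the unique path in $\mathbb{T}_n$ from $t$ to $t'$. For a vertex $s$, $\mathbf{w}_s(t,t')$ is the number of vertices $t''$ on $p(t,t')$ (endpoints included) with $B_{t''}\sim\pm B_s$. *)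

theory Defs
  imports
    "HOL-Analysis.Finite_Cartesian_Product"
    "HOL-Library.Poly_Mapping"
    "HOL-Algebra.Bij"
begin

text \<open>
  The rank is \<open>CARD('n)\<close> for a finite index type \<open>'n\<close>, which plays the role of \<open>{1, \<dots>, n}\<close>;
  permutations are bijections of \<open>'n\<close>. The ambient field is the whole type \<open>'f\<close>.
  That it is a field of rational functions over the rationals in \<open>CARD('n)\<close> variables is
  expressed by the existence of a free generating set, which is part of every labeled seed.
  (Inverses of permutations are written with \<^const>\<open>inv_into\<close> because HOL-Algebra claims
  the notation \<open>inv\<close>.)
\<close>

section \<open>Exchange matrices\<close>

definition skew_symmetrizable :: "int ^ 'n ^ 'n::finite \<Rightarrow> bool" where
  "skew_symmetrizable B \<longleftrightarrow>
     (\<exists>d :: 'n \<Rightarrow> int. (\<forall>i. d i > 0) \<and>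
        (let D = (\<chi> i j. if i = j then d i else 0) in transpose (D ** B) = - (D ** B)))"

definition indecomposable :: "int ^ 'n ^ 'n::finite \<Rightarrow> bool" where
  "indecomposable B \<longleftrightarrow>
     (\<forall>i j. (i, j) \<in> {(i, j). B $ i $ j \<noteq> 0 \<or> B $ j $ i \<noteq> 0}\<^sup>*)"

abbreviation pos_part :: "int \<Rightarrow> int" where
  "pos_part x \<equiv> max x 0"

definition mutate_matrix :: "'n \<Rightarrow> int ^ 'n ^ 'n::finite \<Rightarrow> int ^ 'n ^ 'n" where
  "mutate_matrix k B = (\<chi> i j.
     if i = k \<or> j = k then - B $ i $ j
     else B $ i $ j + B $ i $ k * pos_part (B $ k $ j) + pos_part (- B $ i $ k) * B $ k $ j)"

section \<open>Labeled seeds and mutation\<close>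

type_synonym ('f, 'n) seed = "('f ^ 'n) \<times> (int ^ 'n ^ 'n)"

abbreviation cluster :: "('f, 'n::finite) seed \<Rightarrow> 'f ^ 'n" where
  "cluster S \<equiv> fst S"

abbreviation exchange_matrix :: "('f, 'n::finite) seed \<Rightarrow> int ^ 'n ^ 'n" where
  "exchange_matrix S \<equiv> snd S"

definition is_subring :: "'f::ring_1 set \<Rightarrow> bool" where
  "is_subring S \<longleftrightarrow> 1 \<in> S \<and> (\<forall>a\<in>S. \<forall>b\<in>S. a - b \<in> S \<and> a * b \<in> S)"

definition is_subfield :: "'f::field set \<Rightarrow> bool" where
  "is_subfield S \<longleftrightarrow> is_subring S \<and> (\<forall>a\<in>S. inverse a \<in> S)"

text \<open>Evaluation at \<open>x\<close> of a polynomial over the rationals in the variables \<open>'n\<close>, represented as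
  a finitely supported map from exponent vectors to coefficients.\<close>

definition eval_poly :: "'f::field_char_0 ^ 'n::finite \<Rightarrow> (('n \<Rightarrow>\<^sub>0 nat) \<Rightarrow>\<^sub>0 rat) \<Rightarrow> 'f" where
  "eval_poly x p =
     (\<Sum>m\<in>Poly_Mapping.keys p. of_rat (Poly_Mapping.lookup p m) * (\<Prod>i\<in>UNIV. x $ i ^ Poly_Mapping.lookup m i))"

definition algebraically_independent :: "'f::field_char_0 ^ 'n::finite \<Rightarrow> bool" where
  "algebraically_independent x \<longleftrightarrow> (\<forall>p. eval_poly x p = 0 \<longrightarrow> p = 0)"

text \<open>Every subfield of \<open>'f\<close> contains the rationals, as the characteristic is 0.\<close>

definition free_generating_set :: "'f::field_char_0 ^ 'n::finite \<Rightarrow> bool" where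
  "free_generating_set x \<longleftrightarrow>
     algebraically_independent x \<and> is_subfield hull (range (\<lambda>i. x $ i)) = UNIV"

definition labeled_seed :: "('f::field_char_0, 'n::finite) seed \<Rightarrow> bool" where
  "labeled_seed S \<longleftrightarrow> free_generating_set (cluster S) \<and> skew_symmetrizable (exchange_matrix S)"

definition mutate_cluster :: "'n \<Rightarrow> ('f::field, 'n::finite) seed \<Rightarrow> 'f ^ 'n" where
  "mutate_cluster k S = (let x = cluster S; B = exchange_matrix S in
     (\<chi> i. if i = k
       then inverse (x $ k) * ((\<Prod>j\<in>UNIV. x $ j ^ nat (pos_part (B $ j $ k))) +
                               (\<Prod>j\<in>UNIV. x $ j ^ nat (pos_part (- B $ j $ k))))
       else x $ i))"

definition mutate_seed :: "'n \<Rightarrow> ('f::field, 'n::finite) seed \<Rightarrow> ('f, 'n) seed" where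
  "mutate_seed k S = (mutate_cluster k S, mutate_matrix k (exchange_matrix S))"

section \<open>The regular tree and cluster patterns\<close>

text \<open>\<open>E t k t'\<close> says that \<open>t\<close> and \<open>t'\<close> are joined by an edge labeled \<open>k\<close>. The vertices
  are all elements of the type \<open>'v\<close>.\<close>

definition path_between :: "('v \<Rightarrow> 'n \<Rightarrow> 'v \<Rightarrow> bool) \<Rightarrow> 'v \<Rightarrow> 'v \<Rightarrow> 'v list \<Rightarrow> bool" where
  "path_between E t t' p \<longleftrightarrow>
     p \<noteq> [] \<and> hd p = t \<and> last p = t' \<and> distinct p \<and> successively (\<lambda>u v. \<exists>k. E u k v) p"

definition labeled_regular_tree :: "('v \<Rightarrow> 'n \<Rightarrow> 'v \<Rightarrow> bool) \<Rightarrow> bool" where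
  "labeled_regular_tree E \<longleftrightarrow>
     (\<forall>t k t'. E t k t' \<longrightarrow> t \<noteq> t' \<and> E t' k t) \<and>
     (\<forall>t t' k l. E t k t' \<longrightarrow> E t l t' \<longrightarrow> k = l) \<and>
     (\<forall>t k. \<exists>!t'. E t k t') \<and>
     (\<forall>t t'. \<exists>!p. path_between E t t' p)"

definition tree_path :: "('v \<Rightarrow> 'n \<Rightarrow> 'v \<Rightarrow> bool) \<Rightarrow> 'v \<Rightarrow> 'v \<Rightarrow> 'v list" where
  "tree_path E t t' = (THE p. path_between E t t' p)"

definition cluster_pattern ::
  "('v \<Rightarrow> 'n \<Rightarrow> 'v \<Rightarrow> bool) \<Rightarrow> ('v \<Rightarrow> ('f::field_char_0, 'n::finite) seed) \<Rightarrow> bool" where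
  "cluster_pattern E \<Sigma> \<longleftrightarrow>
     (\<forall>t. labeled_seed (\<Sigma> t)) \<and> (\<forall>t k t'. E t k t' \<longrightarrow> \<Sigma> t' = mutate_seed k (\<Sigma> t))"

definition cluster_algebra :: "('v \<Rightarrow> ('f::field_char_0, 'n::finite) seed) \<Rightarrow> 'f set" where
  "cluster_algebra \<Sigma> = is_subring hull {cluster (\<Sigma> t) $ i | t i. True}"

section \<open>The action of permutations\<close>

definition permute_cluster :: "('n \<Rightarrow> 'n) \<Rightarrow> 'f ^ 'n::finite \<Rightarrow> 'f ^ 'n" where
  "permute_cluster \<sigma> x = (\<chi> i. x $ (inv_into UNIV \<sigma> i))"

definition permute_matrix :: "('n \<Rightarrow> 'n) \<Rightarrow> int ^ 'n ^ 'n::finite \<Rightarrow> int ^ 'n ^ 'n" where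
  "permute_matrix \<sigma> B = (\<chi> i j. B $ (inv_into UNIV \<sigma> i) $ (inv_into UNIV \<sigma> j))"

definition matrix_sim :: "int ^ 'n ^ 'n::finite \<Rightarrow> int ^ 'n ^ 'n \<Rightarrow> bool" where
  "matrix_sim B B' \<longleftrightarrow> (\<exists>\<sigma>. bij \<sigma> \<and> B' = permute_matrix \<sigma> B)"

definition matrix_sim_pm :: "int ^ 'n ^ 'n::finite \<Rightarrow> int ^ 'n ^ 'n \<Rightarrow> bool" where
  "matrix_sim_pm B B' \<longleftrightarrow> matrix_sim B B' \<or> matrix_sim B (- B')"

section \<open>Cluster automorphisms\<close>

definition map_cluster :: "('f \<Rightarrow> 'f) \<Rightarrow> 'f ^ 'n::finite \<Rightarrow> 'f ^ 'n" where
  "map_cluster f x = (\<chi> i. f (x $ i))"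

text \<open>Maps on a subring \<open>A\<close> are taken extensional (undefined outside \<open>A\<close>), as in \<^const>\<open>Bij\<close>.\<close>

definition ring_automorphisms :: "'f::ring_1 set \<Rightarrow> ('f \<Rightarrow> 'f) set" where
  "ring_automorphisms A =
     {f \<in> Bij A. f 1 = 1 \<and> (\<forall>a\<in>A. \<forall>b\<in>A. f (a + b) = f a + f b \<and> f (a * b) = f a * f b)}"

definition cluster_Aut :: "('v \<Rightarrow> ('f::field_char_0, 'n::finite) seed) \<Rightarrow> ('f \<Rightarrow> 'f) set" where
  "cluster_Aut \<Sigma> =
     {f \<in> ring_automorphisms (cluster_algebra \<Sigma>). \<exists>t t' \<sigma>. bij \<sigma> \<and>
        permute_cluster \<sigma> (map_cluster f (cluster (\<Sigma> t))) = cluster (\<Sigma> t') \<and>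
        (\<forall>k. permute_cluster \<sigma> (map_cluster f (mutate_cluster k (\<Sigma> t))) =
               mutate_cluster (\<sigma> k) (\<Sigma> t'))}"

text \<open>The product of \<open>g\<close> and \<open>f\<close> in \<^const>\<open>BijGroup\<close> is \<open>g \<circ> f\<close>.\<close>

definition cluster_Aut_group ::
  "('v \<Rightarrow> ('f::field_char_0, 'n::finite) seed) \<Rightarrow> ('f \<Rightarrow> 'f) monoid" where
  "cluster_Aut_group \<Sigma> = (BijGroup (cluster_algebra \<Sigma>)) \<lparr>carrier := cluster_Aut \<Sigma>\<rparr>"

text \<open>\<open>is_quadruple_aut \<Sigma> S\<^sub>1 S\<^sub>2 \<sigma> \<epsilon> f\<close> means that the quadruple \<open>(S\<^sub>1, S\<^sub>2, \<sigma>, \<epsilon>)\<close> may be written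
  and \<open>f\<close> is the unique cluster automorphism which it denotes.\<close>

definition is_quadruple_aut ::
  "('v \<Rightarrow> ('f::field_char_0, 'n::finite) seed) \<Rightarrow> ('f, 'n) seed \<Rightarrow> ('f, 'n) seed \<Rightarrow>
     ('n \<Rightarrow> 'n) \<Rightarrow> int \<Rightarrow> ('f \<Rightarrow> 'f) \<Rightarrow> bool" where
  "is_quadruple_aut \<Sigma> S\<^sub>1 S\<^sub>2 \<sigma> \<epsilon> f \<longleftrightarrow>
     bij \<sigma> \<and> \<epsilon> \<in> {1, -1} \<and>
     permute_matrix \<sigma> (exchange_matrix S\<^sub>1) = map_matrix (\<lambda>b. \<epsilon> * b) (exchange_matrix S\<^sub>2) \<and>
     f \<in> cluster_Aut \<Sigma> \<and>
     permute_cluster \<sigma> (map_cluster f (cluster S\<^sub>1)) = cluster S\<^sub>2 \<and>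
     (\<forall>g \<in> cluster_Aut \<Sigma>.
        permute_cluster \<sigma> (map_cluster g (cluster S\<^sub>1)) = cluster S\<^sub>2 \<longrightarrow> g = f)"

section \<open>Weights\<close>

definition weight ::
  "('v \<Rightarrow> 'n \<Rightarrow> 'v \<Rightarrow> bool) \<Rightarrow> ('v \<Rightarrow> ('f::field_char_0, 'n::finite) seed) \<Rightarrow> 'v \<Rightarrow> 'v \<Rightarrow> 'v \<Rightarrow> nat" where
  "weight E \<Sigma> s t t' =
     card {t'' \<in> set (tree_path E t t').
             matrix_sim_pm (exchange_matrix (\<Sigma> t'')) (exchange_matrix (\<Sigma> s))}"

definition weighted_auts ::
  "('v \<Rightarrow> 'n \<Rightarrow> 'v \<Rightarrow> bool) \<Rightarrow> ('v \<Rightarrow> ('f::field_char_0, 'n::finite) seed) \<Rightarrow> 'v \<Rightarrow> nat \<Rightarrow> ('f \<Rightarrow> 'f) set"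
where
  "weighted_auts E \<Sigma> t\<^sub>0 m =
     {f \<in> cluster_Aut \<Sigma>. \<exists>s \<sigma> \<epsilon>. weight E \<Sigma> t\<^sub>0 t\<^sub>0 s = m + 1 \<and>
        is_quadruple_aut \<Sigma> (\<Sigma> t\<^sub>0) (\<Sigma> s) \<sigma> \<epsilon> f}"

end

theory Submission
  imports Defs
begin

text \<open>
  A ring automorphism compatible with all mutations of one seed maps exchange polynomials to
  exchange polynomials. By algebraic independence it therefore preserves each column of the
  exchange matrix up to sign, and the signs agree because the matrix is skew-symmetrizable and
  indecomposable. Conversely, if an automorphism carries one seed to another, with matrices
  agreeing up to a global sign, then it carries neighbours to neighbours: the exchange relation
  determines the image of the new variable, as the cluster algebra lies in a field. Hence every
  cluster automorphism carries each seed, in particular the one at the root, to some seed of the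
  pattern, and it is determined by its values on one cluster. Walks are carried to walks through
  similar matrices, so the weight of a composite is bounded by counting along the concatenation
  of a path with the image of another.
\<close>

section \<open>Subrings and their automorphisms\<close>

lemma is_subring_hull: "is_subring (is_subring hull X)"
  by (rule hull_in) (auto simp: is_subring_def)

lemma is_subring_uminus:
  assumes "is_subring A" "a \<in> A"
  shows "- a \<in> A"
proof -
  have "0 \<in> A"
    using assms unfolding is_subring_def by (metis diff_self)
  then show ?thesis
    using assms unfolding is_subring_def by (metis diff_0)
qed

lemma is_subring_add:
  assumes "is_subring A" "a \<in> A" "b \<in> A"
  shows "a + b \<in> A"
  using assms is_subring_uminus[OF assms(1,3)] unfolding is_subring_def
  by (metis diff_minus_eq_add)

lemma is_subring_0: "is_subring A \<Longrightarrow> 0 \<in> A"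
  unfolding is_subring_def by (metis diff_self)

lemma is_subring_mult: "is_subring A \<Longrightarrow> a \<in> A \<Longrightarrow> b \<in> A \<Longrightarrow> a * b \<in> A"
  by (simp add: is_subring_def)

lemma is_subring_power:
  assumes "is_subring A" "a \<in> A"
  shows "a ^ n \<in> A"
  using assms by (induction n) (auto simp: is_subring_def)

lemma is_subring_prod:
  fixes g :: "'i \<Rightarrow> 'f::comm_ring_1"
  assumes "is_subring A" "\<And>i. i \<in> I \<Longrightarrow> g i \<in> A"
  shows "prod g I \<in> A"
  using assms(2)
  by (induction I rule: infinite_finite_induct) (use assms(1) in \<open>auto simp: is_subring_def\<close>)

lemma ring_automorphismsD:
  assumes "f \<in> ring_automorphisms A"
  shows "f 1 = 1"
    and "\<And>a b. a \<in> A \<Longrightarrow> b \<in> A \<Longrightarrow> f (a + b) = f a + f b"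
    and "\<And>a b. a \<in> A \<Longrightarrow> b \<in> A \<Longrightarrow> f (a * b) = f a * f b"
    and "\<And>a. a \<in> A \<Longrightarrow> f a \<in> A"
    and "inj_on f A" and "f ` A = A" and "f \<in> extensional A" and "f \<in> Bij A"
  using assms by (auto simp: ring_automorphisms_def Bij_def bij_betw_def)

lemma ring_automorphism_0:
  assumes "is_subring A" "f \<in> ring_automorphisms A"
  shows "f 0 = 0"
  using ring_automorphismsD(2)[OF assms(2), of 0 0] is_subring_0[OF assms(1)] by simp

lemma ring_automorphism_diff:
  assumes "is_subring A" "f \<in> ring_automorphisms A" "a \<in> A" "b \<in> A"
  shows "f (a - b) = f a - f b"
proof -
  have "a - b \<in> A"
    using assms by (simp add: is_subring_def)
  from ring_automorphismsD(2)[OF assms(2) this assms(4)] show ?thesis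
    by simp
qed

lemma ring_automorphism_power:
  assumes "is_subring A" "f \<in> ring_automorphisms A" "a \<in> A"
  shows "f (a ^ n) = f a ^ n"
  using assms(3) ring_automorphismsD[OF assms(2)] is_subring_power[OF assms(1)]
  by (induction n) auto

lemma ring_automorphism_prod:
  fixes g :: "'i \<Rightarrow> 'f::comm_ring_1"
  assumes "is_subring A" "f \<in> ring_automorphisms A" "\<And>i. i \<in> I \<Longrightarrow> g i \<in> A"
  shows "f (prod g I) = (\<Prod>i\<in>I. f (g i))"
  using assms(3)
proof (induction I rule: infinite_finite_induct)
  case (insert i I)
  have "prod g I \<in> A"
    using insert by (intro is_subring_prod[OF assms(1)]) auto
  then show ?case
    using insert ring_automorphismsD(3)[OF assms(2)] by simp
qed (use ring_automorphismsD(1)[OF assms(2)] in auto)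

lemma ring_automorphisms_compose:
  assumes "is_subring A" "f \<in> ring_automorphisms A" "g \<in> ring_automorphisms A"
  shows "compose A g f \<in> ring_automorphisms A"
  using assms ring_automorphismsD[OF assms(2)] ring_automorphismsD[OF assms(3)]
  unfolding ring_automorphisms_def mem_Collect_eq
  by (auto simp: compose_Bij compose_eq is_subring_add is_subring_def)

lemma ring_automorphisms_id:
  assumes "is_subring A"
  shows "(\<lambda>x\<in>A. x) \<in> ring_automorphisms A"
  using assms unfolding ring_automorphisms_def mem_Collect_eq
  by (auto simp: id_Bij is_subring_add is_subring_def)

lemma ring_automorphisms_inverse:
  assumes "is_subring A" "f \<in> ring_automorphisms A"
  shows "(\<lambda>x\<in>A. inv_into A f x) \<in> ring_automorphisms A"
proof -
  note f = ring_automorphismsD[OF assms(2)]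
  have inv_mem: "inv_into A f a \<in> A" and f_inv: "f (inv_into A f a) = a" if "a \<in> A" for a
    using that f(6) by (auto simp: inv_into_into f_inv_into_f)
  have inv_f: "inv_into A f a = b" if "b \<in> A" "f b = a" for a b
    using that f(5) by auto
  have "1 \<in> A"
    using assms by (simp add: is_subring_def)
  have add: "inv_into A f (a + b) = inv_into A f a + inv_into A f b" if "a \<in> A" "b \<in> A" for a b
    using that by (intro inv_f) (auto simp: f inv_mem f_inv is_subring_add[OF assms(1)])
  have mult: "inv_into A f (a * b) = inv_into A f a * inv_into A f b" if "a \<in> A" "b \<in> A" for a b
    using that by (intro inv_f) (auto simp: f inv_mem f_inv is_subring_mult[OF assms(1)])
  have "inv_into A f 1 = 1"
    using \<open>1 \<in> A\<close> f(1) by (intro inv_f) auto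
  then show ?thesis
    using \<open>1 \<in> A\<close> add mult restrict_inv_into_Bij[OF f(8)]
    unfolding ring_automorphisms_def mem_Collect_eq
    by (auto simp: is_subring_add[OF assms(1)] is_subring_mult[OF assms(1)])
qed

text \<open>The inverse in \<open>BijGroup A\<close> is \<open>inv_into A f\<close> restricted to
  \<open>A\<close>. Closure is asked for in these explicit functions because transport of seeds
  speaks about them directly.\<close>

lemma subgroup_BijGroupI:
  assumes "H \<subseteq> Bij A" "(\<lambda>x\<in>A. x) \<in> H"
    and "\<And>f g. f \<in> H \<Longrightarrow> g \<in> H \<Longrightarrow> compose A g f \<in> H"
    and "\<And>f. f \<in> H \<Longrightarrow> (\<lambda>x\<in>A. inv_into A f x) \<in> H"
  shows "subgroup H (BijGroup A)"
proof (rule group.subgroupI[OF group_BijGroup])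
  show "m_inv (BijGroup A) f \<in> H" if "f \<in> H" for f
    using assms(1,4) that inv_BijGroup[of f A] by auto
qed (use assms in \<open>auto simp: BijGroup_def\<close>)

section \<open>Algebraic independence\<close>

text \<open>Coefficients outside \<open>keys\<close> vanish, so several polynomials can be evaluated
  over one common index set.\<close>

lemma eval_poly_superset:
  assumes "finite S" "Poly_Mapping.keys p \<subseteq> S"
  shows "eval_poly x p = (\<Sum>m\<in>S. of_rat (Poly_Mapping.lookup p m) *
           (\<Prod>i\<in>UNIV. x $ i ^ Poly_Mapping.lookup m i))"
  unfolding eval_poly_def using assms
  by (intro sum.mono_neutral_left) (auto simp: in_keys_iff)

lemma eval_poly_diff: "eval_poly x (p - q) = eval_poly x p - eval_poly x q"
proof -
  let ?S = "Poly_Mapping.keys p \<union> Poly_Mapping.keys q"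
  have "Poly_Mapping.keys (p - q) \<subseteq> ?S"
    by (rule keys_diff)
  then show ?thesis
    by (subst (1 2 3) eval_poly_superset[of ?S])
      (auto simp: lookup_minus of_rat_diff left_diff_distrib sum_subtractf)
qed

lemma eval_poly_add: "eval_poly x (p + q) = eval_poly x p + eval_poly x q"
proof -
  have "eval_poly x (p + q - q) = eval_poly x (p + q) - eval_poly x q"
    by (rule eval_poly_diff)
  then show ?thesis
    by simp
qed

lemma eval_poly_single:
  "eval_poly x (Poly_Mapping.single m 1) = (\<Prod>i\<in>UNIV. x $ i ^ Poly_Mapping.lookup m i)"
  by (simp add: eval_poly_def)

text \<open>A vanishing entry would be a zero of the polynomial consisting of that single variable.
  Nonvanishing is what later permits cancellation in exchange relations.\<close>

lemma algebraically_independent_nonzero: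
  fixes x :: "'f::field_char_0 ^ 'n::finite"
  assumes "algebraically_independent x"
  shows "x $ k \<noteq> 0"
proof
  assume "x $ k = 0"
  let ?p = "Poly_Mapping.single (Poly_Mapping.single k (1::nat)) (1::rat)"
  have "(\<Prod>i\<in>UNIV. x $ i ^ Poly_Mapping.lookup (Poly_Mapping.single k 1) i) = 0"
    using \<open>x $ k = 0\<close> by (intro prod_zero) auto
  then have "eval_poly x ?p = 0"
    by (simp add: eval_poly_single)
  then have "?p = 0"
    using assms unfolding algebraically_independent_def by blast
  then have "Poly_Mapping.lookup ?p (Poly_Mapping.single k 1) = 0"
    by simp
  then show False
    by simp
qed

lemma single_add_single_eq_iff:
  fixes m1 m2 m3 m4 :: "'a"
  assumes "Poly_Mapping.single m1 (1::rat) + Poly_Mapping.single m2 1 =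
           Poly_Mapping.single m3 1 + Poly_Mapping.single m4 1"
  shows "m1 = m3 \<and> m2 = m4 \<or> m1 = m4 \<and> m2 = m3"
proof -
  have *: "(if m1 = m then 1::rat else 0) + (if m2 = m then 1 else 0) =
         (if m3 = m then 1 else 0) + (if m4 = m then 1 else 0)" for m
    using arg_cong[OF assms, of "\<lambda>p. Poly_Mapping.lookup p m"]
    by (simp add: lookup_add lookup_single when_def)
  show ?thesis
    \<comment> \<open>Coefficients are compared at the four indices. Since 1 + 1 is nonzero in the
      rationals, a repeated index on one side forces the same repetition on the other.\<close>
    using *[of m1] *[of m2] *[of m3] *[of m4] by (auto split: if_splits)
qed

text \<open>The difference of the two binomials vanishes at \<open>x\<close>, hence is the zero
  polynomial. Only the unordered pair of monomials is recovered, and this is where the sign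
  ambiguity of exchange matrices comes from.\<close>

lemma algebraically_independent_binomial:
  fixes x :: "'f::field_char_0 ^ 'n::finite" and a b c d :: "'n \<Rightarrow> nat"
  assumes "algebraically_independent x"
    and "(\<Prod>i\<in>UNIV. x $ i ^ a i) + (\<Prod>i\<in>UNIV. x $ i ^ b i) =
         (\<Prod>i\<in>UNIV. x $ i ^ c i) + (\<Prod>i\<in>UNIV. x $ i ^ d i)"
  shows "a = c \<and> b = d \<or> a = d \<and> b = c"
proof -
  \<comment> \<open>The index type is finite, so every exponent function has finite support.\<close>
  have lookup: "Poly_Mapping.lookup (Abs_poly_mapping e) = e" for e :: "'n \<Rightarrow> nat"
    by (rule Abs_poly_mapping_inverse) simp
  let ?mon = "\<lambda>e. Poly_Mapping.single (Abs_poly_mapping e) (1::rat)"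
  have "eval_poly x ((?mon a + ?mon b) - (?mon c + ?mon d)) = 0"
    using assms(2) by (simp add: eval_poly_diff eval_poly_add eval_poly_single lookup)
  then have "(?mon a + ?mon b) - (?mon c + ?mon d) = 0"
    using assms(1) unfolding algebraically_independent_def by blast
  then have "?mon a + ?mon b = ?mon c + ?mon d"
    by simp
  from single_add_single_eq_iff[OF this] show ?thesis
    by (metis lookup)
qed

section \<open>Exchange relations\<close>

text \<open>The product of the old and the new variable. It isolates the part of a mutation that is
  polynomial in the cluster, so that an automorphism defined only on a subring can be evaluated on
  it without forming inverses.\<close>

definition exchange_polynomial :: "'n \<Rightarrow> ('f::field, 'n::finite) seed \<Rightarrow> 'f" where
  "exchange_polynomial k S =
     (\<Prod>j\<in>UNIV. cluster S $ j ^ nat (pos_part (exchange_matrix S $ j $ k))) +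
     (\<Prod>j\<in>UNIV. cluster S $ j ^ nat (pos_part (- exchange_matrix S $ j $ k)))"

lemma mutate_cluster_nth:
  "mutate_cluster k S $ i =
     (if i = k then inverse (cluster S $ k) * exchange_polynomial k S else cluster S $ i)"
  by (simp add: mutate_cluster_def exchange_polynomial_def Let_def)

lemma exchange_relation:
  "cluster S $ k \<noteq> 0 \<Longrightarrow> cluster S $ k * mutate_cluster k S $ k = exchange_polynomial k S"
  by (simp add: mutate_cluster_nth)

lemma ring_automorphism_exchange_polynomial:
  assumes "is_subring A" "f \<in> ring_automorphisms A" "\<And>j. cluster S $ j \<in> A"
  shows "f (exchange_polynomial k S) =
     (\<Prod>j\<in>UNIV. f (cluster S $ j) ^ nat (pos_part (exchange_matrix S $ j $ k))) +
     (\<Prod>j\<in>UNIV. f (cluster S $ j) ^ nat (pos_part (- exchange_matrix S $ j $ k)))"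
proof -
  have pw: "cluster S $ j ^ a \<in> A" for j a
    by (intro is_subring_power assms)
  then have pr: "(\<Prod>j\<in>UNIV. cluster S $ j ^ e j) \<in> A" for e
    by (intro is_subring_prod assms)
  show ?thesis
    unfolding exchange_polynomial_def
    by (simp add: ring_automorphismsD(2)[OF assms(2) pr pr] ring_automorphism_prod[OF assms(1,2) pw]
        ring_automorphism_power[OF assms(1,2,3)])
qed

lemma skew_symmetrizable_sign:
  assumes "skew_symmetrizable B"
  obtains d :: "'n::finite \<Rightarrow> int"
  where "\<And>i. d i > 0" "\<And>i j. d i * B $ i $ j = - (d j * B $ j $ i)"
proof -
  obtain d where d: "\<And>i. d i > 0"
    and *: "transpose ((\<chi> i j. if i = j then d i else 0) ** B) =
            - ((\<chi> i j. if i = j then d i else 0) ** B)"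
    using assms unfolding skew_symmetrizable_def Let_def by blast
  have entry: "((\<chi> i j. if i = j then d i else 0) ** B) $ i $ j = d i * B $ i $ j" for i j
    by (simp add: matrix_matrix_mult_def if_distrib[where f = "\<lambda>x. x * _"] cong: if_cong)
  have "d i * B $ i $ j = - (d j * B $ j $ i)" for i j
    using arg_cong[OF *, of "\<lambda>M. M $ j $ i"] by (simp add: transpose_def entry)
  with d show ?thesis
    using that by blast
qed

text \<open>Opposite entries of a skew-symmetrizable matrix have opposite signs, so the signs of the
  columns of two neighbours in the graph of the matrix agree.\<close>

lemma column_signs_uniform:
  fixes B B' :: "int ^ 'n ^ 'n::finite"
  assumes "skew_symmetrizable B" "skew_symmetrizable B'" "indecomposable B"
    and \<epsilon>: "\<And>k. \<epsilon> k \<in> {1, -1}" "\<And>j k. B $ j $ k = \<epsilon> k * B' $ \<sigma> j $ \<sigma> k"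
  shows "\<epsilon> k = \<epsilon> (l::'n)"
proof -
  obtain d where d: "\<And>i. d i > 0" "\<And>i j. d i * B $ i $ j = - (d j * B $ j $ i)"
    using skew_symmetrizable_sign[OF assms(1)] by blast
  obtain d' where d': "\<And>i. d' i > 0" "\<And>i j. d' i * B' $ i $ j = - (d' j * B' $ j $ i)"
    using skew_symmetrizable_sign[OF assms(2)] by blast
  have edge: "\<epsilon> i = \<epsilon> j" if "B $ i $ j \<noteq> 0 \<or> B $ j $ i \<noteq> 0" for i j
  proof (rule ccontr)
    assume "\<epsilon> i \<noteq> \<epsilon> j"
    then have \<epsilon>j: "\<epsilon> j = - \<epsilon> i"
      using \<epsilon>(1)[of i] \<epsilon>(1)[of j] by auto
    let ?b = "B' $ \<sigma> i $ \<sigma> j" and ?c = "B' $ \<sigma> j $ \<sigma> i"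
    \<comment> \<open>The two entries of \<open>B\<close> carry the signs of columns j and i, which
      are opposite here. This cancels the minus sign of skew-symmetrizability for \<open>B\<close>,
      while the one for \<open>B'\<close> remains below. So \<open>?b\<close> and \<open>?c\<close>
      would have both equal and opposite signs.\<close>
    have 1: "d i * ?b = d j * ?c"
      using d(2)[of i j] \<epsilon>(1)[of i] unfolding \<epsilon>(2) \<epsilon>j by auto
    have 2: "d' (\<sigma> i) * ?b = - (d' (\<sigma> j) * ?c)"
      by (rule d'(2))
    have "?b = 0 \<and> ?c = 0"
    proof -
      have "sgn ?b = sgn ?c"
        using arg_cong[OF 1, of sgn] d(1)[of i] d(1)[of j] by (simp add: sgn_mult)
      moreover have "sgn ?b = - sgn ?c"
        using arg_cong[OF 2, of sgn] d'(1)[of "\<sigma> i"] d'(1)[of "\<sigma> j"] by (simp add: sgn_mult)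
      ultimately have "sgn ?b = 0" "sgn ?c = 0"
        by auto
      then show ?thesis
        by (simp add: sgn_0_0)
    qed
    with that show False
      by (simp add: \<epsilon>(2))
  qed
  have "(k, l) \<in> {(i, j). B $ i $ j \<noteq> 0 \<or> B $ j $ i \<noteq> 0}\<^sup>*"
    using assms(3) unfolding indecomposable_def by blast
  then show ?thesis
    by (induction rule: rtrancl_induct) (auto simp: edge)
qed

lemma pos_part_parts_eq:
  "nat (pos_part a) = nat (pos_part b) \<Longrightarrow> nat (pos_part (- a)) = nat (pos_part (- b)) \<Longrightarrow> a = b"
  by auto

text \<open>Mutation commutes with relabelling and with a global change of sign, so the relation
  between two matrices survives mutation in corresponding directions.\<close>

lemma mutate_matrix_sign_permute:
  fixes B B' :: "int ^ 'n ^ 'n::finite"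
  assumes "bij \<sigma>" "\<epsilon> \<in> {1, -1}" "\<And>i j. B $ i $ j = \<epsilon> * B' $ \<sigma> i $ \<sigma> j"
  shows "mutate_matrix k B $ i $ j = \<epsilon> * mutate_matrix (\<sigma> k) B' $ \<sigma> i $ \<sigma> j"
proof -
  have eq: "\<sigma> i = \<sigma> k \<longleftrightarrow> i = k" for i
    using assms(1) by (auto simp: bij_def inj_eq)
  \<comment> \<open>The only nontrivial part of commuting with negation: both products sum to the
    same up to sign because x equals the positive part of x minus the positive part of -x.\<close>
  have *: "- a * max (- b) 0 + max a 0 * - b = - (a * max b 0 + max (- a) 0 * b)" for a b :: int
    by (auto simp: max_def)
  show ?thesis
    using assms(2) *[of "B' $ \<sigma> i $ \<sigma> k" "B' $ \<sigma> k $ \<sigma> j"]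
    by (auto simp: mutate_matrix_def eq assms(3))
qed

section \<open>Paths in trees\<close>

text \<open>Loop erasure: the tail is shortened first, and if the head recurs in the shortened tail,
  everything before that occurrence is dropped.\<close>

lemma walk_contains_path:
  assumes "w \<noteq> []" "successively R w"
  shows "\<exists>p. p \<noteq> [] \<and> hd p = hd w \<and> last p = last w \<and> distinct p \<and> successively R p \<and> set p \<subseteq> set w"
  using assms
proof (induction w)
  case (Cons a w)
  show ?case
  proof (cases "w = []")
    case True
    then show ?thesis
      by (intro exI[of _ "[a]"]) auto
  next
    case False
    with Cons obtain p where p: "p \<noteq> []" "hd p = hd w" "last p = last w" "distinct p"
      "successively R p" "set p \<subseteq> set w"
      by (auto simp: successively_Cons)
    show ?thesis
    proof (cases "a \<in> set p")
      case True
      then obtain ys zs where "p = ys @ a # zs"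
        by (auto simp: in_set_conv_decomp)
      then show ?thesis
        using p False by (intro exI[of _ "a # zs"]) (auto simp: successively_append_iff)
    next
      assume "a \<notin> set p"
      then show ?thesis
        using p False Cons.prems by (intro exI[of _ "a # p"]) (auto simp: successively_Cons)
    qed
  qed
qed auto

lemma list_all2_last: "list_all2 P p q \<Longrightarrow> p \<noteq> [] \<Longrightarrow> P (last p) (last q)"
  by (induction rule: list_all2_induct) auto

lemma path_between_tree_path:
  "labeled_regular_tree E \<Longrightarrow> path_between E t t' (tree_path E t t')"
  unfolding tree_path_def labeled_regular_tree_def by (metis theI')

lemma tree_path_eq:
  "labeled_regular_tree E \<Longrightarrow> path_between E t t' p \<Longrightarrow> tree_path E t t' = p"
  using path_between_tree_path[of E t t'] unfolding labeled_regular_tree_def by blast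

text \<open>Paths in a tree are unique, so the loop erasure of a walk is the tree path. Weights can
  therefore be bounded by counting along any walk.\<close>

lemma tree_path_subset_walk:
  assumes "labeled_regular_tree E" "w \<noteq> []" "successively (\<lambda>u v. \<exists>k. E u k v) w"
  shows "set (tree_path E (hd w) (last w)) \<subseteq> set w"
proof -
  obtain p where "path_between E (hd w) (last w) p" "set p \<subseteq> set w"
    using walk_contains_path[OF assms(2,3)] unfolding path_between_def by blast
  then show ?thesis
    using tree_path_eq[OF assms(1)] by blast
qed

section \<open>Transport of seeds\<close>

text \<open>Substituting \<open>\<sigma> j\<close> for the index removes the inverse permutation;
  all later arguments use this form.\<close>

lemma permute_cluster_eq_iff:
  assumes "bij \<sigma>"
  shows "permute_cluster \<sigma> (map_cluster f x) = y \<longleftrightarrow> (\<forall>j. f (x $ j) = y $ \<sigma> j)"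
  using assms unfolding permute_cluster_def map_cluster_def vec_eq_iff
  by (simp, metis bij_inv_eq_iff)

lemma permute_matrix_eq_iff:
  assumes "bij \<sigma>"
  shows "permute_matrix \<sigma> B = map_matrix (\<lambda>b. \<epsilon> * b) B' \<longleftrightarrow>
           (\<forall>i j. B $ i $ j = \<epsilon> * B' $ \<sigma> i $ \<sigma> j)"
  using assms unfolding permute_matrix_def map_matrix_def vec_eq_iff
  by (simp, metis bij_inv_eq_iff)

text \<open>A sign parameter replaces the disjunction, so that symmetry and transitivity reduce to
  inverting and multiplying signs and permutations.\<close>

lemma matrix_sim_pm_iff:
  "matrix_sim_pm B B' \<longleftrightarrow>
     (\<exists>\<sigma> \<epsilon>. bij \<sigma> \<and> \<epsilon> \<in> {1, -1} \<and> (\<forall>i j. B $ i $ j = \<epsilon> * B' $ \<sigma> i $ \<sigma> j))"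
proof -
  have "map_matrix (\<lambda>b. 1 * b) B' = B'" "map_matrix (\<lambda>b. - 1 * b) B' = - B'"
    by (simp_all add: map_matrix_def vec_eq_iff)
  then have "matrix_sim_pm B B' \<longleftrightarrow>
     (\<exists>\<sigma>. bij \<sigma> \<and> ((\<forall>i j. B $ i $ j = 1 * B' $ \<sigma> i $ \<sigma> j) \<or> (\<forall>i j. B $ i $ j = - 1 * B' $ \<sigma> i $ \<sigma> j)))"
    using permute_matrix_eq_iff[of _ B 1 B'] permute_matrix_eq_iff[of _ B "- 1" B']
    unfolding matrix_sim_pm_def matrix_sim_def by metis
  then show ?thesis
    by blast
qed

lemma matrix_sim_pm_refl: "matrix_sim_pm B B"
  unfolding matrix_sim_pm_iff by (intro exI[of _ id] exI[of _ 1]) auto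

lemma matrix_sim_pm_sym:
  assumes "matrix_sim_pm B B'"
  shows "matrix_sim_pm B' B"
proof -
  obtain \<sigma> \<epsilon> where *: "bij \<sigma>" "\<epsilon> \<in> {1, -1}" "\<And>i j. B $ i $ j = \<epsilon> * B' $ \<sigma> i $ \<sigma> j"
    using assms unfolding matrix_sim_pm_iff by blast
  have "B' $ i $ j = \<epsilon> * B $ inv_into UNIV \<sigma> i $ inv_into UNIV \<sigma> j" for i j
    using *(1,2) by (auto simp: *(3) bij_is_surj surj_f_inv_f)
  then show ?thesis
    using *(1,2) bij_imp_bij_inv unfolding matrix_sim_pm_iff by blast
qed

lemma matrix_sim_pm_trans:
  assumes "matrix_sim_pm B B'" "matrix_sim_pm B' B''"
  shows "matrix_sim_pm B B''"
proof -
  obtain \<sigma> \<epsilon> where *: "bij \<sigma>" "\<epsilon> \<in> {1, -1}" "\<And>i j. B $ i $ j = \<epsilon> * B' $ \<sigma> i $ \<sigma> j"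
    using assms unfolding matrix_sim_pm_iff by blast
  obtain \<tau> \<delta> where **: "bij \<tau>" "\<delta> \<in> {1, -1}" "\<And>i j. B' $ i $ j = \<delta> * B'' $ \<tau> i $ \<tau> j"
    using assms unfolding matrix_sim_pm_iff by blast
  have "B $ i $ j = (\<epsilon> * \<delta>) * B'' $ (\<tau> \<circ> \<sigma>) i $ (\<tau> \<circ> \<sigma>) j" for i j
    by (simp add: *(3) **(3))
  moreover have "bij (\<tau> \<circ> \<sigma>)" "\<epsilon> * \<delta> \<in> {1, -1}"
    using * ** by (auto simp: bij_comp)
  ultimately show ?thesis
    unfolding matrix_sim_pm_iff by blast
qed

text \<open>The data of a quadruple in index form. Neither membership in the automorphism group nor
  uniqueness is included, so the relation can be propagated seed by seed.\<close>

definition carries ::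
  "('f \<Rightarrow> 'f) \<Rightarrow> ('n \<Rightarrow> 'n) \<Rightarrow> int \<Rightarrow> ('f, 'n::finite) seed \<Rightarrow> ('f, 'n) seed \<Rightarrow> bool" where
  "carries f \<sigma> \<epsilon> S S' \<longleftrightarrow> bij \<sigma> \<and> \<epsilon> \<in> {1, -1} \<and>
     (\<forall>j. f (cluster S $ j) = cluster S' $ \<sigma> j) \<and>
     (\<forall>i j. exchange_matrix S $ i $ j = \<epsilon> * exchange_matrix S' $ \<sigma> i $ \<sigma> j)"

lemma carries_sim_pm: "carries f \<sigma> \<epsilon> S S' \<Longrightarrow> matrix_sim_pm (exchange_matrix S) (exchange_matrix S')"
  unfolding carries_def matrix_sim_pm_iff by blast

lemma carries_compose:
  assumes "carries f \<sigma> \<epsilon> S S'" "carries g \<tau> \<delta> S' S''" "\<And>j. cluster S $ j \<in> A"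
  shows "carries (compose A g f) (\<tau> \<circ> \<sigma>) (\<epsilon> * \<delta>) S S''"
  using assms unfolding carries_def by (auto simp: bij_comp compose_eq)

lemma carries_inverse:
  assumes "carries f \<sigma> \<epsilon> S S'" "inj_on f A" "\<And>j. cluster S $ j \<in> A" "\<And>j. cluster S' $ j \<in> A"
  shows "carries (\<lambda>x\<in>A. inv_into A f x) (inv_into UNIV \<sigma>) \<epsilon> S' S"
proof -
  have \<sigma>: "bij \<sigma>" and [simp]: "\<sigma> (inv_into UNIV \<sigma> j) = j" for j
    using assms(1) by (auto simp: carries_def bij_is_surj surj_f_inv_f)
  have "inv_into A f (cluster S' $ j) = cluster S $ inv_into UNIV \<sigma> j" for j
  proof -
    have "cluster S' $ j = f (cluster S $ inv_into UNIV \<sigma> j)"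
      using assms(1) by (simp add: carries_def)
    then show ?thesis
      using assms(2,3) by simp
  qed
  moreover have "exchange_matrix S' $ i $ j =
      \<epsilon> * exchange_matrix S $ inv_into UNIV \<sigma> i $ inv_into UNIV \<sigma> j" for i j
    using assms(1) by (auto simp: carries_def)
  ultimately show ?thesis
    using assms(1,4) bij_imp_bij_inv[OF \<sigma>] unfolding carries_def by auto
qed

text \<open>A sign -1 interchanges the two monomials, and their sum does not notice.\<close>

lemma carries_exchange_polynomial:
  assumes "carries f \<sigma> \<epsilon> S S'" "is_subring A" "f \<in> ring_automorphisms A" "\<And>j. cluster S $ j \<in> A"
  shows "f (exchange_polynomial k S) = exchange_polynomial (\<sigma> k) S'"
proof -
  have \<sigma>: "bij \<sigma>" and \<epsilon>: "\<epsilon> \<in> {1, -1}"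
    and f: "\<And>j. f (cluster S $ j) = cluster S' $ \<sigma> j"
    and B: "\<And>i j. exchange_matrix S $ i $ j = \<epsilon> * exchange_matrix S' $ \<sigma> i $ \<sigma> j"
    using assms(1) by (auto simp: carries_def)
  have reindex: "(\<Prod>j\<in>UNIV. h (\<sigma> j)) = (\<Prod>j\<in>UNIV. h j)" for h :: "_ \<Rightarrow> 'a"
    by (rule prod.reindex_bij_betw[OF \<sigma>])
  have "exchange_polynomial (\<sigma> k) S' =
      (\<Prod>j\<in>UNIV. cluster S' $ \<sigma> j ^ nat (pos_part (exchange_matrix S' $ \<sigma> j $ \<sigma> k))) +
      (\<Prod>j\<in>UNIV. cluster S' $ \<sigma> j ^ nat (pos_part (- exchange_matrix S' $ \<sigma> j $ \<sigma> k)))"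
    unfolding exchange_polynomial_def
    by (simp only: reindex[of "\<lambda>j. cluster S' $ j ^ nat (pos_part (exchange_matrix S' $ j $ \<sigma> k))"]
        reindex[of "\<lambda>j. cluster S' $ j ^ nat (pos_part (- exchange_matrix S' $ j $ \<sigma> k))"])
  then show ?thesis
    using \<epsilon> by (auto simp: ring_automorphism_exchange_polynomial[OF assms(2-4)] f B add.commute)
qed

section \<open>Transport along edges and walks of a fixed cluster pattern\<close>

locale cluster_pattern_on_tree =
  fixes E :: "'v \<Rightarrow> 'n::finite \<Rightarrow> 'v \<Rightarrow> bool"
    and \<Sigma> :: "'v \<Rightarrow> ('f::field_char_0, 'n) seed"
  assumes tree: "labeled_regular_tree E"
    and pattern: "cluster_pattern E \<Sigma>"
    and indec: "indecomposable (exchange_matrix (\<Sigma> t))"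
begin

abbreviation adjacent :: "'v \<Rightarrow> 'v \<Rightarrow> bool" where
  "adjacent u v \<equiv> \<exists>k. E u k v"

abbreviation \<A> :: "'f set" where
  "\<A> \<equiv> cluster_algebra \<Sigma>"

lemma subring: "is_subring \<A>"
  unfolding cluster_algebra_def by (rule is_subring_hull)

lemma cluster_mem: "cluster (\<Sigma> t) $ i \<in> \<A>"
  unfolding cluster_algebra_def by (rule hull_inc) blast

lemma ex_edge: "\<exists>t'. E t k t'"
  using tree unfolding labeled_regular_tree_def by blast

lemma mutate: "E t k t' \<Longrightarrow> \<Sigma> t' = mutate_seed k (\<Sigma> t)"
  using pattern unfolding cluster_pattern_def by blast

lemma mutate_cluster_mem: "mutate_cluster k (\<Sigma> t) $ i \<in> \<A>"
proof -
  obtain t' where "E t k t'"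
    using ex_edge by blast
  from mutate[OF this] cluster_mem[of t' i] show ?thesis
    by (simp add: mutate_seed_def)
qed

lemma independent: "algebraically_independent (cluster (\<Sigma> t))"
  using pattern unfolding cluster_pattern_def labeled_seed_def free_generating_set_def by blast

lemma skew: "skew_symmetrizable (exchange_matrix (\<Sigma> t))"
  using pattern unfolding cluster_pattern_def labeled_seed_def by blast

lemma cluster_nonzero: "cluster (\<Sigma> t) $ i \<noteq> 0"
  by (rule algebraically_independent_nonzero[OF independent])

lemma walk_exists: obtains w where "w \<noteq> []" "hd w = t" "last w = t'" "successively adjacent w"
  using path_between_tree_path[OF tree, of t t'] unfolding path_between_def by blast

lemma ring_automorphism_exchange:
  assumes "f \<in> ring_automorphisms \<A>"
  shows "f (cluster (\<Sigma> t) $ k) * f (mutate_cluster k (\<Sigma> t) $ k) = f (exchange_polynomial k (\<Sigma> t))"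
  using ring_automorphismsD(3)[OF assms cluster_mem mutate_cluster_mem]
    exchange_relation[OF cluster_nonzero] by metis

text \<open>The mutated variable lies in \<A>, so \<open>f\<close> respects the exchange relation.
  Dividing by the nonzero old variable at \<open>u\<close> leaves the image of the new one.\<close>

lemma carries_mutate_cluster:
  assumes "f \<in> ring_automorphisms \<A>" "carries f \<sigma> \<epsilon> (\<Sigma> t) (\<Sigma> u)"
  shows "f (mutate_cluster k (\<Sigma> t) $ j) = mutate_cluster (\<sigma> k) (\<Sigma> u) $ \<sigma> j"
proof (cases "j = k")
  case True
  have "cluster (\<Sigma> u) $ \<sigma> k * f (mutate_cluster k (\<Sigma> t) $ k) =
        cluster (\<Sigma> u) $ \<sigma> k * mutate_cluster (\<sigma> k) (\<Sigma> u) $ \<sigma> k"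
    using ring_automorphism_exchange[OF assms(1), of t k] assms(2)
      carries_exchange_polynomial[OF assms(2) subring assms(1) cluster_mem, of k]
      exchange_relation[OF cluster_nonzero, of u "\<sigma> k"]
    by (simp add: carries_def)
  then show ?thesis
    using True cluster_nonzero by simp
next
  case False
  moreover have "\<sigma> j \<noteq> \<sigma> k"
    using False assms(2) by (auto simp: carries_def bij_def inj_eq)
  ultimately show ?thesis
    using assms(2) by (simp add: carries_def mutate_cluster_nth)
qed

lemma carries_edge:
  assumes "f \<in> ring_automorphisms \<A>" "carries f \<sigma> \<epsilon> (\<Sigma> t) (\<Sigma> u)" "E t k t'" "E u (\<sigma> k) u'"
  shows "carries f \<sigma> \<epsilon> (\<Sigma> t') (\<Sigma> u')"
  using carries_mutate_cluster[OF assms(1,2), of k] assms(2)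
    mutate_matrix_sign_permute[of \<sigma> \<epsilon> "exchange_matrix (\<Sigma> t)" "exchange_matrix (\<Sigma> u)" k]
  unfolding carries_def mutate[OF assms(3)] mutate[OF assms(4)] mutate_seed_def by simp

text \<open>Each edge label is translated by the same \<sigma>, so one permutation and one sign
  serve for the whole walk. The image is claimed to be a walk only, possibly with
  repetitions.\<close>

lemma carries_walk:
  assumes "f \<in> ring_automorphisms \<A>" "carries f \<sigma> \<epsilon> (\<Sigma> (hd p)) (\<Sigma> u)"
    and "p \<noteq> []" "successively adjacent p"
  shows "\<exists>q. q \<noteq> [] \<and> hd q = u \<and> successively adjacent q \<and>
           list_all2 (\<lambda>a b. carries f \<sigma> \<epsilon> (\<Sigma> a) (\<Sigma> b)) p q"
  using assms(2-)
proof (induction p arbitrary: u)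
  case (Cons a p)
  show ?case
  proof (cases "p = []")
    case True
    then show ?thesis
      using Cons.prems by (intro exI[of _ "[u]"]) auto
  next
    case False
    then obtain k where k: "E a k (hd p)" and p: "successively adjacent p"
      using Cons.prems by (auto simp: successively_Cons)
    obtain u' where u': "E u (\<sigma> k) u'"
      using ex_edge by blast
    have "carries f \<sigma> \<epsilon> (\<Sigma> (hd p)) (\<Sigma> u')"
      using carries_edge[where \<sigma> = \<sigma> and t = a and u = u, OF assms(1) _ k u'] Cons.prems(1) by simp
    from Cons.IH[OF this False p] obtain q where "q \<noteq> []" "hd q = u'" "successively adjacent q"
      "list_all2 (\<lambda>a b. carries f \<sigma> \<epsilon> (\<Sigma> a) (\<Sigma> b)) p q"
      by blast
    then show ?thesis
      using u' Cons.prems(1) by (intro exI[of _ "u # q"]) (auto simp: successively_Cons)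
  qed
qed auto

lemma carries_everywhere:
  assumes "f \<in> ring_automorphisms \<A>" "carries f \<sigma> \<epsilon> (\<Sigma> t) (\<Sigma> u)"
  shows "\<exists>u'. carries f \<sigma> \<epsilon> (\<Sigma> t') (\<Sigma> u')"
proof -
  obtain w where "w \<noteq> []" "hd w = t" "last w = t'" "successively adjacent w"
    by (rule walk_exists)
  then show ?thesis
    using carries_walk[OF assms(1), of \<sigma> \<epsilon> w u] assms(2) list_all2_last by metis
qed

text \<open>Applying \<open>f\<close> to the exchange relation in direction k gives two equal
  binomials in the independent cluster at \<open>u\<close>. This fixes column k up to a sign, and
  indecomposability makes the signs agree.\<close>

lemma mutations_determine_matrix:
  assumes "f \<in> ring_automorphisms \<A>" "bij \<sigma>"
    and f: "\<And>j. f (cluster (\<Sigma> t) $ j) = cluster (\<Sigma> u) $ \<sigma> j"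
    and mut: "\<And>k. f (mutate_cluster k (\<Sigma> t) $ k) = mutate_cluster (\<sigma> k) (\<Sigma> u) $ \<sigma> k"
  shows "\<exists>\<epsilon>. carries f \<sigma> \<epsilon> (\<Sigma> t) (\<Sigma> u)"
proof -
  let ?B = "exchange_matrix (\<Sigma> t)" and ?B' = "exchange_matrix (\<Sigma> u)" and ?x = "cluster (\<Sigma> u)"
  have reindex: "(\<Prod>j\<in>UNIV. h (\<sigma> j) ^ a j) = (\<Prod>j\<in>UNIV. h j ^ a (inv_into UNIV \<sigma> j))"
    for h :: "'n \<Rightarrow> 'f" and a
    using prod.reindex_bij_betw[OF assms(2), of "\<lambda>j. h j ^ a (inv_into UNIV \<sigma> j)"] assms(2)
    by (simp add: bij_is_inj)
  have "\<exists>e. e \<in> {1, -1} \<and> (\<forall>j. ?B $ j $ k = e * ?B' $ \<sigma> j $ \<sigma> k)" for k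
  proof -
    \<comment> \<open>The exponents of the image are reindexed by \<sigma>, so that both sides refer
      to the variables at \<open>u\<close>; s = 1 and s = -1 select the two monomials.\<close>
    let ?a = "\<lambda>s j. nat (pos_part (s * ?B $ inv_into UNIV \<sigma> j $ k))"
    let ?b = "\<lambda>s j. nat (pos_part (s * ?B' $ j $ \<sigma> k))"
    have "f (exchange_polynomial k (\<Sigma> t)) = exchange_polynomial (\<sigma> k) (\<Sigma> u)"
      using ring_automorphism_exchange[OF assms(1), of t k]
        exchange_relation[OF cluster_nonzero, of u "\<sigma> k"] by (simp add: f mut)
    moreover have "f (exchange_polynomial k (\<Sigma> t)) =
        (\<Prod>j\<in>UNIV. ?x $ j ^ ?a 1 j) + (\<Prod>j\<in>UNIV. ?x $ j ^ ?a (-1) j)"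
      by (simp add: ring_automorphism_exchange_polynomial[OF subring assms(1) cluster_mem] f
          reindex[where h = "\<lambda>j. ?x $ j"])
    moreover have "exchange_polynomial (\<sigma> k) (\<Sigma> u) =
        (\<Prod>j\<in>UNIV. ?x $ j ^ ?b 1 j) + (\<Prod>j\<in>UNIV. ?x $ j ^ ?b (-1) j)"
      by (simp add: exchange_polynomial_def)
    ultimately have "(\<Prod>j\<in>UNIV. ?x $ j ^ ?a 1 j) + (\<Prod>j\<in>UNIV. ?x $ j ^ ?a (-1) j) =
               (\<Prod>j\<in>UNIV. ?x $ j ^ ?b 1 j) + (\<Prod>j\<in>UNIV. ?x $ j ^ ?b (-1) j)"
      by simp
    from algebraically_independent_binomial[OF independent this]
    consider "?a 1 = ?b 1" "?a (-1) = ?b (-1)" | "?a 1 = ?b (-1)" "?a (-1) = ?b 1"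
      by blast
    then show ?thesis
    proof cases
      case 1
      have "?B $ j $ k = ?B' $ \<sigma> j $ \<sigma> k" for j
        using fun_cong[OF 1(1), of "\<sigma> j"] fun_cong[OF 1(2), of "\<sigma> j"] assms(2)
        by (intro pos_part_parts_eq) (auto simp: bij_is_inj)
      then show ?thesis
        by auto
    next
      case 2
      have "?B $ j $ k = - ?B' $ \<sigma> j $ \<sigma> k" for j
        using fun_cong[OF 2(1), of "\<sigma> j"] fun_cong[OF 2(2), of "\<sigma> j"] assms(2)
        by (intro pos_part_parts_eq) (auto simp: bij_is_inj)
      then show ?thesis
        by auto
    qed
  qed
  then obtain \<epsilon> where \<epsilon>: "\<And>k. \<epsilon> k \<in> {1, -1}" "\<And>j k. ?B $ j $ k = \<epsilon> k * ?B' $ \<sigma> j $ \<sigma> k"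
    by metis
  have "\<epsilon> k = \<epsilon> l" for k l
    by (rule column_signs_uniform[OF skew skew indec \<epsilon>])
  then show ?thesis
    using \<epsilon> assms(2) f unfolding carries_def by metis
qed

section \<open>Cluster automorphisms and quadruples in terms of carried seeds\<close>

lemma cluster_Aut_iff:
  "f \<in> cluster_Aut \<Sigma> \<longleftrightarrow>
     f \<in> ring_automorphisms \<A> \<and> (\<exists>\<sigma> \<epsilon> t u. carries f \<sigma> \<epsilon> (\<Sigma> t) (\<Sigma> u))"
proof
  assume "f \<in> cluster_Aut \<Sigma>"
  then obtain t u \<sigma> where f: "f \<in> ring_automorphisms \<A>" and \<sigma>: "bij \<sigma>"
    and "\<And>j. f (cluster (\<Sigma> t) $ j) = cluster (\<Sigma> u) $ \<sigma> j"
    and "\<And>k j. f (mutate_cluster k (\<Sigma> t) $ j) = mutate_cluster (\<sigma> k) (\<Sigma> u) $ \<sigma> j"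
    unfolding cluster_Aut_def by (simp add: permute_cluster_eq_iff cong: conj_cong) blast
  \<comment> \<open>The definition constrains clusters only; the matrix relation is recovered from
    the images of the neighbouring clusters.\<close>
  then show "f \<in> ring_automorphisms \<A> \<and> (\<exists>\<sigma> \<epsilon> t u. carries f \<sigma> \<epsilon> (\<Sigma> t) (\<Sigma> u))"
    using mutations_determine_matrix[OF f \<sigma>] by blast
next
  assume "f \<in> ring_automorphisms \<A> \<and> (\<exists>\<sigma> \<epsilon> t u. carries f \<sigma> \<epsilon> (\<Sigma> t) (\<Sigma> u))"
  then obtain \<sigma> \<epsilon> t u where f: "f \<in> ring_automorphisms \<A>" "carries f \<sigma> \<epsilon> (\<Sigma> t) (\<Sigma> u)"
    by blast
  then show "f \<in> cluster_Aut \<Sigma>"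
    using carries_mutate_cluster[OF f] unfolding cluster_Aut_def carries_def mem_Collect_eq
    by (metis permute_cluster_eq_iff)
qed

lemma cluster_Aut_from:
  assumes "f \<in> cluster_Aut \<Sigma>"
  obtains \<sigma> \<epsilon> s where "carries f \<sigma> \<epsilon> (\<Sigma> t) (\<Sigma> s)"
  using assms carries_everywhere unfolding cluster_Aut_iff by metis

text \<open>Agreement on one cluster spreads over each edge by cancelling in the exchange relation,
  hence to all cluster variables and to the subring they generate.\<close>

lemma ring_automorphism_unique:
  assumes f: "f \<in> ring_automorphisms \<A>" and g: "g \<in> ring_automorphisms \<A>"
    and t: "\<And>j. f (cluster (\<Sigma> t) $ j) = g (cluster (\<Sigma> t) $ j)"
  shows "f = g"
proof -
  have edge: "f (cluster (\<Sigma> b) $ j) = g (cluster (\<Sigma> b) $ j)"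
    if a: "\<And>j. f (cluster (\<Sigma> a) $ j) = g (cluster (\<Sigma> a) $ j)" and e: "E a k b" for a b k j
  proof (cases "j = k")
    case True
    have "f (exchange_polynomial k (\<Sigma> a)) = g (exchange_polynomial k (\<Sigma> a))"
      by (simp add: ring_automorphism_exchange_polynomial[OF subring _ cluster_mem] f g a)
    then have "f (cluster (\<Sigma> a) $ k) * f (mutate_cluster k (\<Sigma> a) $ k) =
               f (cluster (\<Sigma> a) $ k) * g (mutate_cluster k (\<Sigma> a) $ k)"
      using ring_automorphism_exchange[OF f, of a k] ring_automorphism_exchange[OF g, of a k]
      by (simp add: a)
    moreover have "f (cluster (\<Sigma> a) $ k) \<noteq> 0"
      using ring_automorphismsD(5)[OF f] ring_automorphism_0[OF subring f] is_subring_0[OF subring]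
        cluster_mem cluster_nonzero by (metis inj_onD)
    ultimately show ?thesis
      using True by (simp add: mutate[OF e] mutate_seed_def)
  next
    case False
    then show ?thesis
      by (simp add: mutate[OF e] mutate_seed_def mutate_cluster_nth a)
  qed
  have walk: "f (cluster (\<Sigma> (last w)) $ j) = g (cluster (\<Sigma> (last w)) $ j)"
    if "w \<noteq> []" "successively adjacent w" "\<And>j. f (cluster (\<Sigma> (hd w)) $ j) = g (cluster (\<Sigma> (hd w)) $ j)"
    for w j
    using that
  proof (induction w)
    case (Cons a w)
    show ?case
    proof (cases "w = []")
      case True
      then show ?thesis
        using Cons.prems by simp
    next
      case False
      with Cons.prems obtain k where "E a k (hd w)" "successively adjacent w"
        by (auto simp: successively_Cons)
      then show ?thesis
        using Cons.IH edge[of a k "hd w"] Cons.prems(3) False by auto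
    qed
  qed auto
  have vars: "f (cluster (\<Sigma> b) $ j) = g (cluster (\<Sigma> b) $ j)" for b j
    using walk t by (metis walk_exists[of t b])
  have "f x = g x" if "x \<in> \<A>" for x
  proof -
    have "x \<in> \<A> \<and> f x = g x"
      using that unfolding cluster_algebra_def
    proof (rule hull_induct)
      \<comment> \<open>Membership in \<A> is kept in the set because \<open>f\<close> and
        \<open>g\<close> respect the operations only there.\<close>
      show "is_subring {x. x \<in> is_subring hull {cluster (\<Sigma> t) $ i |t i. True} \<and> f x = g x}"
        unfolding cluster_algebra_def[symmetric] using subring
        by (auto simp: is_subring_def ring_automorphism_diff[OF subring] f g
            ring_automorphismsD(1,3)[OF f] ring_automorphismsD(1,3)[OF g])
    qed (auto simp: vars hull_inc)
    then show ?thesis ..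
  qed
  then show ?thesis
    using ring_automorphismsD(7)[OF f] ring_automorphismsD(7)[OF g] by (auto intro: extensionalityI)
qed

text \<open>The uniqueness clause is automatic, since an automorphism is determined by its values on
  one cluster.\<close>

lemma is_quadruple_aut_iff:
  "is_quadruple_aut \<Sigma> (\<Sigma> t) (\<Sigma> s) \<sigma> \<epsilon> f \<longleftrightarrow>
     f \<in> ring_automorphisms \<A> \<and> carries f \<sigma> \<epsilon> (\<Sigma> t) (\<Sigma> s)"
proof
  assume "is_quadruple_aut \<Sigma> (\<Sigma> t) (\<Sigma> s) \<sigma> \<epsilon> f"
  then show "f \<in> ring_automorphisms \<A> \<and> carries f \<sigma> \<epsilon> (\<Sigma> t) (\<Sigma> s)"
    unfolding is_quadruple_aut_def carries_def
    by (auto simp: cluster_Aut_iff permute_cluster_eq_iff permute_matrix_eq_iff)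
next
  assume *: "f \<in> ring_automorphisms \<A> \<and> carries f \<sigma> \<epsilon> (\<Sigma> t) (\<Sigma> s)"
  then have \<sigma>: "bij \<sigma>" and "f \<in> cluster_Aut \<Sigma>"
    by (auto simp: carries_def cluster_Aut_iff)
  moreover have "g = f" if "g \<in> cluster_Aut \<Sigma>"
    "permute_cluster \<sigma> (map_cluster g (cluster (\<Sigma> t))) = cluster (\<Sigma> s)" for g
    using * that \<sigma> ring_automorphism_unique[of g f t]
    by (auto simp: cluster_Aut_iff carries_def permute_cluster_eq_iff)
  ultimately show "is_quadruple_aut \<Sigma> (\<Sigma> t) (\<Sigma> s) \<sigma> \<epsilon> f"
    using * \<sigma>
    unfolding is_quadruple_aut_def carries_def permute_cluster_eq_iff[OF \<sigma>] permute_matrix_eq_iff[OF \<sigma>]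
    by blast
qed

lemma weighted_auts_iff:
  "f \<in> weighted_auts E \<Sigma> t m \<longleftrightarrow> f \<in> ring_automorphisms \<A> \<and>
     (\<exists>\<sigma> \<epsilon> s. carries f \<sigma> \<epsilon> (\<Sigma> t) (\<Sigma> s) \<and> weight E \<Sigma> t t s = m + 1)"
  unfolding weighted_auts_def by (auto simp: is_quadruple_aut_iff cluster_Aut_iff)

section \<open>Weights\<close>

definition similar_to :: "'v \<Rightarrow> 'v set" where
  "similar_to s = {t. matrix_sim_pm (exchange_matrix (\<Sigma> t)) (exchange_matrix (\<Sigma> s))}"

lemma weight_eq: "weight E \<Sigma> s t t' = card (set (tree_path E t t') \<inter> similar_to s)"
  unfolding weight_def similar_to_def by (rule arg_cong[of _ _ card]) auto

lemma tree_path_endpoints: "t \<in> set (tree_path E t t')" "t' \<in> set (tree_path E t t')"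
  using path_between_tree_path[OF tree, of t t'] unfolding path_between_def
  by (metis hd_in_set, metis last_in_set)

lemma self_similar: "t \<in> similar_to t"
  by (simp add: similar_to_def matrix_sim_pm_refl)

lemma carries_similar_iff:
  "carries f \<sigma> \<epsilon> (\<Sigma> a) (\<Sigma> b) \<Longrightarrow> a \<in> similar_to s \<longleftrightarrow> b \<in> similar_to s"
  unfolding similar_to_def mem_Collect_eq
  using carries_sim_pm matrix_sim_pm_sym matrix_sim_pm_trans by blast

lemma carries_similar: "carries f \<sigma> \<epsilon> (\<Sigma> t) (\<Sigma> s) \<Longrightarrow> s \<in> similar_to t"
  using carries_similar_iff self_similar by blast

lemma weight_pos: "weight E \<Sigma> t t s > 0"
  unfolding weight_eq card_gt_0_iff using tree_path_endpoints(1) self_similar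
  by (metis IntI empty_iff finite_Int finite_set)

lemma weight_self: "weight E \<Sigma> t t t = 1"
proof -
  have "tree_path E t t = [t]"
    by (rule tree_path_eq[OF tree]) (simp add: path_between_def)
  then show ?thesis
    by (simp add: weight_eq self_similar)
qed

text \<open>A carried seed has a similar matrix, so both endpoints of the path are counted and a
  single count forces them to coincide.\<close>

lemma weight_one_iff:
  assumes "carries f \<sigma> \<epsilon> (\<Sigma> t) (\<Sigma> s)"
  shows "weight E \<Sigma> t t s = 1 \<longleftrightarrow> s = t"
proof
  assume "weight E \<Sigma> t t s = 1"
  then obtain v where "set (tree_path E t s) \<inter> similar_to t = {v}"
    unfolding weight_eq by (auto simp: card_1_singleton_iff)
  moreover have "t \<in> set (tree_path E t s) \<inter> similar_to t" "s \<in> set (tree_path E t s) \<inter> similar_to t"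
    using tree_path_endpoints self_similar carries_similar[OF assms] by auto
  ultimately show "s = t"
    by (metis singletonD)
qed (simp add: weight_self)

text \<open>Lists are compared position by position, because the image walk may visit a vertex twice
  and cardinalities need not match.\<close>

lemma carries_filter_length:
  assumes "list_all2 (\<lambda>a b. carries f \<sigma> \<epsilon> (\<Sigma> a) (\<Sigma> b)) p q"
  shows "length (filter (\<lambda>a. a \<in> similar_to s) p) = length (filter (\<lambda>b. b \<in> similar_to s) q)"
  using assms by (induction rule: list_all2_induct) (auto simp: carries_similar_iff)

text \<open>The path from \<open>t\<close> to \<open>u\<close> lies in the walk formed by the path from \<open>t\<close> to \<open>r\<close> and the image
  under \<open>g\<close> of the path from \<open>t\<close> to \<open>s\<close>; the vertex \<open>r\<close> is counted in both parts.\<close>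

lemma weight_compose:
  assumes g: "g \<in> ring_automorphisms \<A>" "carries g \<tau> \<delta> (\<Sigma> t) (\<Sigma> r)"
  obtains u where "carries g \<tau> \<delta> (\<Sigma> s) (\<Sigma> u)"
    "weight E \<Sigma> t t u + 1 \<le> weight E \<Sigma> t t r + weight E \<Sigma> t t s"
proof -
  let ?S = "similar_to t" and ?p = "tree_path E t s" and ?p' = "tree_path E t r"
  have p: "?p \<noteq> []" "hd ?p = t" "last ?p = s" "successively adjacent ?p" "distinct ?p"
    and p': "?p' \<noteq> []" "hd ?p' = t" "last ?p' = r" "successively adjacent ?p'"
    using path_between_tree_path[OF tree, of t s] path_between_tree_path[OF tree, of t r]
    unfolding path_between_def by auto
  obtain q where q: "q \<noteq> []" "hd q = r" "successively adjacent q"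
    and pq: "list_all2 (\<lambda>a b. carries g \<tau> \<delta> (\<Sigma> a) (\<Sigma> b)) ?p q"
    using carries_walk[OF g(1), of \<tau> \<delta> ?p r] g(2) p by auto
  \<comment> \<open>The shared vertex \<open>r\<close> is removed from the second walk, so that the
    concatenation is again a walk.\<close>
  obtain q' where q_eq: "q = r # q'"
    using q by (cases q) auto
  let ?w = "?p' @ q'"
  have "successively adjacent ?w"
    using p' q(3) unfolding q_eq by (auto simp: successively_append_iff successively_Cons)
  moreover have "?w \<noteq> []" "hd ?w = t" "last ?w = last q"
    using p' by (auto simp: last_append q_eq)
  ultimately have "set (tree_path E t (last q)) \<subseteq> set ?w"
    using tree_path_subset_walk[OF tree, of ?w] by metis
  also have "\<dots> \<subseteq> set ?p' \<union> set q"
    by (auto simp: q_eq)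
  finally have "weight E \<Sigma> t t (last q) \<le> card ((set ?p' \<inter> ?S) \<union> (set q \<inter> ?S))"
    unfolding weight_eq by (intro card_mono) auto
  moreover have "card ((set ?p' \<inter> ?S) \<union> (set q \<inter> ?S)) + card ((set ?p' \<inter> ?S) \<inter> (set q \<inter> ?S)) =
      weight E \<Sigma> t t r + card (set q \<inter> ?S)"
    unfolding weight_eq by (rule card_Un_Int[symmetric]) auto
  moreover have "r \<in> (set ?p' \<inter> ?S) \<inter> (set q \<inter> ?S)"
    using tree_path_endpoints carries_similar[OF g(2)] q by auto
  then have "card ((set ?p' \<inter> ?S) \<inter> (set q \<inter> ?S)) > 0"
    by (auto simp: card_gt_0_iff)
  moreover have "card (set q \<inter> ?S) \<le> weight E \<Sigma> t t s"
  proof -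
    \<comment> \<open>Repetitions in \<open>q\<close> can only lower the cardinality, whereas
      \<open>?p\<close> is distinct and its count is exact.\<close>
    have "set q \<inter> ?S = set (filter (\<lambda>b. b \<in> ?S) q)"
      by auto
    then have "card (set q \<inter> ?S) \<le> length (filter (\<lambda>b. b \<in> ?S) q)"
      by (metis card_length)
    also have "\<dots> = length (filter (\<lambda>a. a \<in> ?S) ?p)"
      by (rule carries_filter_length[OF pq, symmetric])
    also have "\<dots> = card (set (filter (\<lambda>a. a \<in> ?S) ?p))"
      by (rule distinct_card[symmetric]) (use p in simp)
    also have "set (filter (\<lambda>a. a \<in> ?S) ?p) = set ?p \<inter> ?S"
      by auto
    finally show ?thesis
      by (simp add: weight_eq)
  qed
  ultimately have "weight E \<Sigma> t t (last q) + 1 \<le> weight E \<Sigma> t t r + weight E \<Sigma> t t s"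
    by linarith
  moreover have "carries g \<tau> \<delta> (\<Sigma> s) (\<Sigma> (last q))"
    using list_all2_last[OF pq p(1)] p by simp
  ultimately show ?thesis
    using that by blast
qed

section \<open>Composition and exhaustion by weight\<close>

lemma weighted_auts_compose:
  assumes "f \<in> weighted_auts E \<Sigma> t k" "g \<in> weighted_auts E \<Sigma> t l"
  shows "compose \<A> g f \<in> (\<Union>m\<in>{0..k + l}. weighted_auts E \<Sigma> t m)"
proof -
  obtain \<sigma> \<epsilon> s where f: "f \<in> ring_automorphisms \<A>" "carries f \<sigma> \<epsilon> (\<Sigma> t) (\<Sigma> s)"
    "weight E \<Sigma> t t s = k + 1"
    using assms(1) unfolding weighted_auts_iff by blast
  obtain \<tau> \<delta> r where g: "g \<in> ring_automorphisms \<A>" "carries g \<tau> \<delta> (\<Sigma> t) (\<Sigma> r)"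
    "weight E \<Sigma> t t r = l + 1"
    using assms(2) unfolding weighted_auts_iff by blast
  obtain u where u: "carries g \<tau> \<delta> (\<Sigma> s) (\<Sigma> u)"
    "weight E \<Sigma> t t u + 1 \<le> weight E \<Sigma> t t r + weight E \<Sigma> t t s"
    using weight_compose[OF g(1,2)] by blast
  \<comment> \<open>The index is one less than the weight, since the root is always counted. With
    weights k + 1 and l + 1 and one vertex counted twice, the bound becomes k + l.\<close>
  define m where "m = weight E \<Sigma> t t u - 1"
  have "weight E \<Sigma> t t u = m + 1"
    using weight_pos[of t u] by (simp add: m_def)
  then have "compose \<A> g f \<in> weighted_auts E \<Sigma> t m"
    using carries_compose[OF f(2) u(1) cluster_mem] ring_automorphisms_compose[OF subring f(1) g(1)]
    unfolding weighted_auts_iff by blast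
  moreover have "m \<le> k + l"
    using u(2) f(3) g(3) by (simp add: m_def)
  ultimately show ?thesis
    by auto
qed

lemma cluster_Aut_eq_Union: "cluster_Aut \<Sigma> = (\<Union>m. weighted_auts E \<Sigma> t m)"
proof (intro equalityI subsetI)
  fix f assume "f \<in> cluster_Aut \<Sigma>"
  then obtain \<sigma> \<epsilon> s where "carries f \<sigma> \<epsilon> (\<Sigma> t) (\<Sigma> s)"
    by (rule cluster_Aut_from)
  then have "f \<in> weighted_auts E \<Sigma> t (weight E \<Sigma> t t s - 1)"
    using \<open>f \<in> cluster_Aut \<Sigma>\<close> weight_pos[of t s] unfolding weighted_auts_iff cluster_Aut_iff by auto
  then show "f \<in> (\<Union>m. weighted_auts E \<Sigma> t m)"
    by blast
qed (auto simp: weighted_auts_def)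

section \<open>Groups of cluster automorphisms\<close>

lemma carries_id: "carries (\<lambda>x\<in>\<A>. x) id 1 (\<Sigma> t) (\<Sigma> t)"
  by (simp add: carries_def cluster_mem)

lemma subgroup_cluster_Aut: "subgroup (cluster_Aut \<Sigma>) (BijGroup \<A>)"
proof (rule subgroup_BijGroupI)
  show "cluster_Aut \<Sigma> \<subseteq> Bij \<A>"
    by (auto simp: cluster_Aut_def ring_automorphismsD)
  show "(\<lambda>x\<in>\<A>. x) \<in> cluster_Aut \<Sigma>"
    using carries_id ring_automorphisms_id[OF subring] unfolding cluster_Aut_iff by blast
next
  fix f g assume f: "f \<in> cluster_Aut \<Sigma>" and g: "g \<in> cluster_Aut \<Sigma>"
  obtain \<sigma> \<epsilon> t u where fc: "carries f \<sigma> \<epsilon> (\<Sigma> t) (\<Sigma> u)"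
    using f unfolding cluster_Aut_iff by blast
  \<comment> \<open>The seeds that witness \<open>g\<close> need not begin where \<open>f\<close>
    ends, but \<open>g\<close> carries every seed somewhere, in particular the one at
    \<open>u\<close>.\<close>
  obtain \<tau> \<delta> v where gc: "carries g \<tau> \<delta> (\<Sigma> u) (\<Sigma> v)"
    using cluster_Aut_from[OF g] .
  show "compose \<A> g f \<in> cluster_Aut \<Sigma>"
    using carries_compose[OF fc gc cluster_mem] ring_automorphisms_compose[OF subring] f g
    unfolding cluster_Aut_iff by blast
next
  fix f assume "f \<in> cluster_Aut \<Sigma>"
  then obtain \<sigma> \<epsilon> t u where f: "f \<in> ring_automorphisms \<A>" and fc: "carries f \<sigma> \<epsilon> (\<Sigma> t) (\<Sigma> u)"
    unfolding cluster_Aut_iff by blast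
  show "(\<lambda>x\<in>\<A>. inv_into \<A> f x) \<in> cluster_Aut \<Sigma>"
    using carries_inverse[OF fc ring_automorphismsD(5)[OF f] cluster_mem cluster_mem]
      ring_automorphisms_inverse[OF subring f] unfolding cluster_Aut_iff by blast
qed

text \<open>Weight 1 forces the target vertex to be the root itself. Level 0 is thus the stabilizer
  of the root seed up to relabelling and sign, which makes closure under inverses visible.\<close>

lemma weighted_auts_0_iff:
  "f \<in> weighted_auts E \<Sigma> t 0 \<longleftrightarrow>
     f \<in> ring_automorphisms \<A> \<and> (\<exists>\<sigma> \<epsilon>. carries f \<sigma> \<epsilon> (\<Sigma> t) (\<Sigma> t))"
  unfolding weighted_auts_iff add_0 using weight_one_iff by metis

lemma subgroup_weighted_auts_0: "subgroup (weighted_auts E \<Sigma> t 0) (BijGroup \<A>)"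
proof (rule subgroup_BijGroupI)
  show "weighted_auts E \<Sigma> t 0 \<subseteq> Bij \<A>"
    by (auto simp: weighted_auts_iff ring_automorphismsD)
  show "(\<lambda>x\<in>\<A>. x) \<in> weighted_auts E \<Sigma> t 0"
    using carries_id ring_automorphisms_id[OF subring] unfolding weighted_auts_0_iff by blast
next
  fix f g assume "f \<in> weighted_auts E \<Sigma> t 0" "g \<in> weighted_auts E \<Sigma> t 0"
  then show "compose \<A> g f \<in> weighted_auts E \<Sigma> t 0"
    \<comment> \<open>With both indices 0, the union on the right has index 0 only.\<close>
    using weighted_auts_compose[of f t 0 g 0] by simp
next
  fix f assume "f \<in> weighted_auts E \<Sigma> t 0"
  then obtain \<sigma> \<epsilon> where f: "f \<in> ring_automorphisms \<A>" and fc: "carries f \<sigma> \<epsilon> (\<Sigma> t) (\<Sigma> t)"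
    unfolding weighted_auts_0_iff by blast
  show "(\<lambda>x\<in>\<A>. inv_into \<A> f x) \<in> weighted_auts E \<Sigma> t 0"
    using carries_inverse[OF fc ring_automorphismsD(5)[OF f] cluster_mem cluster_mem]
      ring_automorphisms_inverse[OF subring f] unfolding weighted_auts_0_iff by blast
qed

lemma subgroup_weighted_auts_0_cluster_Aut:
  "subgroup (weighted_auts E \<Sigma> t 0) (cluster_Aut_group \<Sigma>)"
  unfolding cluster_Aut_group_def
  by (rule group.subgroup_incl[OF group_BijGroup subgroup_weighted_auts_0 subgroup_cluster_Aut])
    (auto simp: weighted_auts_def)

end

theorem proposition3p8:
  fixes E :: "'v \<Rightarrow> 'n::finite \<Rightarrow> 'v \<Rightarrow> bool"
    and \<Sigma> :: "'v \<Rightarrow> ('f::field_char_0, 'n) seed"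
    and t\<^sub>0 :: 'v
  assumes "labeled_regular_tree E"
    and "cluster_pattern E \<Sigma>"
    and "\<forall>t. indecomposable (exchange_matrix (\<Sigma> t))"
  shows "cluster_Aut \<Sigma> = (\<Union>m. weighted_auts E \<Sigma> t\<^sub>0 m) \<and>
    subgroup (weighted_auts E \<Sigma> t\<^sub>0 0) (cluster_Aut_group \<Sigma>) \<and>
    (\<forall>k l. \<forall>f \<in> weighted_auts E \<Sigma> t\<^sub>0 k. \<forall>g \<in> weighted_auts E \<Sigma> t\<^sub>0 l.
       compose (cluster_algebra \<Sigma>) g f \<in> (\<Union>m\<in>{0..k + l}. weighted_auts E \<Sigma> t\<^sub>0 m))"
proof -
  interpret cluster_pattern_on_tree E \<Sigma>
    using assms by unfold_locales auto
  show ?thesis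
    by (intro conjI allI ballI cluster_Aut_eq_Union subgroup_weighted_auts_0_cluster_Aut
        weighted_auts_compose)
qed

end
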